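(* Assume that a Hamel basis of $\mathbb{R}$ over $\mathbb{Q}$ exists. Then the space $(\mathbb{R},\tau_{\mathcal{H}})$ is meager in itself (of first category), i.e. $\mathbb{R}$ is a countable union of $\tau_{\mathcal{H}}$-nowhere dense sets.
   Context: The existence of a Hamel basis (a basis of $\mathbb{R}$ as a $\mathbb{Q}$-vector space) is assumed in addition to ZF. A function $H:\mathbb{R}\to\mathbb{R}$ is additive if $H(x+y)=H(x)+H(y)$ for all $x,y$. $\tau_{\mathcal{H}}$ is the initial topology on $\mathbb{R}$ generated by all additive functions, i.e. the smallest topology making every additive $H$ continuous as a map from $(\mathbb{R},\tau_{\mathcal{H}})$ to $\mathbb{R}$ with the usual topology. *)

theory Defs
  imports "HOL-Analysis.Analysis"
begin

global_interpretation rat_real: vector_space "\<lambda>(q::rat) (x::real). of_rat q * x"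
  by unfold_locales (simp_all add: algebra_simps of_rat_add of_rat_mult)

definition hamel_basis :: "real set \<Rightarrow> bool" where
  "hamel_basis B \<longleftrightarrow> rat_real.independent B \<and> rat_real.span B = UNIV"

text \<open>
  The locale predicate is written \<open>Modules.additive\<close> because the short name is taken
  by set-function additivity in \<open>Sigma_Algebra\<close>.
\<close>

definition hamel_topology :: "real topology" where
  "hamel_topology =
     topology_generated_by {H -` U | H U. Modules.additive (H :: real \<Rightarrow> real) \<and> open U}"

definition nowhere_dense_in :: "'a topology \<Rightarrow> 'a set \<Rightarrow> bool" where
  "nowhere_dense_in X S \<longleftrightarrow> S \<subseteq> topspace X \<and> X interior_of (X closure_of S) = {}"

definition meager_in :: "'a topology \<Rightarrow> 'a set \<Rightarrow> bool" where
  "meager_in X S \<longleftrightarrow>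
     (\<exists>\<F>. countable \<F> \<and> (\<forall>N\<in>\<F>. nowhere_dense_in X N) \<and> S = \<Union>\<F>)"

text \<open>
  The next three lemmas confirm that \<open>hamel_topology\<close> is a topology on all of the reals,
  makes every additive function continuous, and is the coarsest one that does.
\<close>

lemma topspace_hamel_topology [simp]: "topspace hamel_topology = UNIV"
proof -
  have "Modules.additive (\<lambda>x::real. x)"
    by unfold_locales simp
  then have "(\<lambda>x::real. x) -` UNIV \<in> {H -` U | H U. Modules.additive (H :: real \<Rightarrow> real) \<and> open U}"
    using open_UNIV by blast
  then show ?thesis
    unfolding hamel_topology_def topology_generated_by_topspace by fastforce
qed

lemma continuous_map_hamel_topology:
  assumes "Modules.additive (H :: real \<Rightarrow> real)"
  shows "continuous_map hamel_topology euclidean H"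
  unfolding continuous_map_alt
proof (intro conjI allI impI)
  fix U :: "real set" assume "openin euclidean U"
  then have "openin hamel_topology (H -` U)"
    unfolding hamel_topology_def using assms
    by (intro topology_generated_by_Basis) auto
  then show "openin hamel_topology (H -` U \<inter> topspace hamel_topology)"
    by simp
qed auto

lemma hamel_topology_coarsest:
  assumes T: "topspace T = UNIV"
    and cont: "\<And>H :: real \<Rightarrow> real. Modules.additive H \<Longrightarrow> continuous_map T euclidean H"
    and "openin hamel_topology V"
  shows "openin T V"
proof -
  have "continuous_map T hamel_topology (\<lambda>x. x)"
    unfolding hamel_topology_def
  proof (rule continuous_on_generated_topo)
    show "(\<lambda>x. x) ` topspace T
        \<subseteq> \<Union> {H -` U | H U. Modules.additive (H :: real \<Rightarrow> real) \<and> open U}"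
      using topspace_hamel_topology
      unfolding hamel_topology_def topology_generated_by_topspace by simp
  next
    fix W assume "W \<in> {H -` U | H U. Modules.additive (H :: real \<Rightarrow> real) \<and> open U}"
    then obtain H U where "Modules.additive (H :: real \<Rightarrow> real)" "open U" "W = H -` U"
      by blast
    with cont[of H] T show "openin T ((\<lambda>x. x) -` W \<inter> topspace T)"
      by (auto simp: continuous_map_alt)
  qed
  with \<open>openin hamel_topology V\<close> T show ?thesis
    by (auto simp: continuous_map_alt)
qed

end

theory Submission
  imports Defs
begin

text \<open>
  Fix a Hamel basis \<open>B\<close> and write a real number in coordinates with respect to \<open>B\<close>. The reals are
  the union over \<open>n\<close> of the sets \<open>L n\<close> of numbers with at most \<open>n\<close> nonzero coordinates, and each
  \<open>L n\<close> is closed and has empty interior.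

  It is closed because every coordinate is a rational-valued additive function, hence continuous: if
  \<open>x\<close> has more than \<open>n\<close> nonzero coordinates, they all stay nonzero on a neighbourhood of \<open>x\<close>
  (\<open>openin_hamel_more_than_coordinates\<close>).

  It has empty interior because additive functions commute with division by positive integers, so
  that \<open>x + z / k\<close> tends to \<open>x\<close> in the Hamel topology for all \<open>x\<close> and \<open>z\<close>
  (\<open>hamel_open_eventually\<close>). The basis is infinite, the reals being uncountable, so \<open>z\<close> can be
  taken to be the sum of \<open>n + 1\<close> basis elements that do not occur in \<open>x\<close>; then every \<open>x + z / k\<close>
  has more than \<open>n\<close> nonzero coordinates (\<open>direction_increasing_coordinates\<close>).
\<close>

lemma additive_of_nat_mult:
  fixes H :: "real \<Rightarrow> real"
  assumes "Modules.additive H"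
  shows "H (real k * z) = real k * H z"
proof (induction k)
  case 0
  show ?case using additive.zero[OF assms] by simp
next
  case (Suc k)
  then show ?case using additive.add[OF assms] by (simp add: algebra_simps)
qed

lemma additive_divide_of_nat:
  fixes H :: "real \<Rightarrow> real"
  assumes "Modules.additive H"
  shows "H (z / real (Suc k)) = H z / real (Suc k)"
proof -
  have "real (Suc k) * H (z / real (Suc k)) = H z"
    using additive_of_nat_mult[OF assms, of "Suc k" "z / real (Suc k)"] by simp
  then show ?thesis by (simp add: field_simps)
qed

text \<open>
  The property of \<open>W\<close> asserted here passes to finite intersections and arbitrary unions, so it is
  enough to see it for the subbasic sets \<open>H -` U\<close>, where \<open>H (x + z / k) = H x + H z / k\<close> tends
  to \<open>H x\<close>.
\<close>

lemma hamel_open_eventually: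
  assumes "openin hamel_topology W" "x \<in> W"
  shows "\<forall>\<^sub>F k in sequentially. x + z / real (Suc k) \<in> W"
proof -
  have "generate_topology_on {H -` U | H U. Modules.additive (H :: real \<Rightarrow> real) \<and> open U} W"
    using assms(1) by (simp add: hamel_topology_def openin_topology_generated_by_iff)
  then show ?thesis using assms(2)
  proof (induction rule: generate_topology_on.induct)
    case Empty
    then show ?case by simp
  next
    case (Int a b)
    then show ?case by (simp add: eventually_conj_iff)
  next
    case (UN K)
    then obtain k where k: "k \<in> K" "x \<in> k" by blast
    then have "\<forall>\<^sub>F n in sequentially. x + z / real (Suc n) \<in> k" using UN by blast
    then show ?case by (rule eventually_mono) (use k in blast)
  next
    case (Basis s)
    then obtain H U where H: "Modules.additive (H :: real \<Rightarrow> real)" and U: "open U" "s = H -` U"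
      by blast
    have "(\<lambda>k. H x + H z * inverse (real (Suc k))) \<longlonglongrightarrow> H x + H z * 0"
      by (intro tendsto_intros LIMSEQ_inverse_real_of_nat)
    moreover have "H (x + z / real (Suc k)) = H x + H z * inverse (real (Suc k))" for k
      using additive.add[OF H] additive_divide_of_nat[OF H] by (simp add: divide_inverse)
    ultimately have "(\<lambda>k. H (x + z / real (Suc k))) \<longlonglongrightarrow> H x" by simp
    moreover have "H x \<in> U" using Basis U by simp
    ultimately show ?case
      using U topological_tendstoD[of "\<lambda>k. H (x + z / real (Suc k))" "H x" sequentially U] by simp
  qed
qed

text \<open>
  With a finite basis, the coordinates would embed the reals into the countable set of functions
  from \<open>B\<close> to the rationals.
\<close>

lemma hamel_basis_infinite:
  assumes "hamel_basis B"
  shows "infinite B"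
proof
  assume fin: "finite B"
  have ind: "rat_real.independent B" and sp: "rat_real.span B = UNIV"
    using assms by (auto simp: hamel_basis_def)
  define r where "r x = restrict (rat_real.representation B x) B" for x
  have "x = y" if "r x = r y" for x y
  proof -
    have "(\<Sum>b\<in>B. of_rat (rat_real.representation B x b) * b)
        = (\<Sum>b\<in>B. of_rat (rat_real.representation B y b) * b)"
      using that by (intro sum.cong refl) (metis r_def restrict_apply')
    then show ?thesis
      using rat_real.sum_representation_eq[OF ind _ fin order_refl] sp by simp
  qed
  then have "inj r" by (rule injI)
  moreover have "range r \<subseteq> (\<Pi>\<^sub>E b\<in>B. UNIV)" by (auto simp: r_def)
  then have "countable (range r)"
    by (rule countable_subset) (intro countable_PiE fin countableI_type)
  ultimately have "countable (UNIV :: real set)" using countable_image_inj_on by blast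
  then show False using uncountable_UNIV_real by blast
qed

lemma additive_representation:
  assumes "hamel_basis B"
  shows "Modules.additive (\<lambda>x. of_rat (rat_real.representation B x b) :: real)"
  using assms by unfold_locales (simp add: hamel_basis_def rat_real.representation_add of_rat_add)

lemma openin_hamel_more_than_coordinates:
  assumes B: "hamel_basis B"
  shows "openin hamel_topology {x. n < card {b. rat_real.representation B x b \<noteq> 0}}"
proof (subst openin_subopen, intro ballI)
  fix x assume x: "x \<in> {x. n < card {b. rat_real.representation B x b \<noteq> 0}}"
  define S where "S = {b. rat_real.representation B x b \<noteq> 0}"
  have finS: "finite S" by (simp add: S_def rat_real.finite_representation)
  have "openin hamel_topology {y. rat_real.representation B y b \<noteq> 0}" for b
  proof -
    have "openin hamel_topology ((\<lambda>x. of_rat (rat_real.representation B x b) :: real) -` (- {0}))"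
      unfolding hamel_topology_def using additive_representation[OF B]
      by (intro topology_generated_by_Basis) blast
    then show ?thesis by (simp add: vimage_def)
  qed
  moreover have "S \<noteq> {}"
    using x unfolding S_def by (metis (no_types) card.empty mem_Collect_eq not_less_zero)
  ultimately have "openin hamel_topology (\<Inter>b\<in>S. {y. rat_real.representation B y b \<noteq> 0})"
    using finS by (intro openin_INT2) auto
  moreover have "n < card {b. rat_real.representation B y b \<noteq> 0}"
    if "y \<in> (\<Inter>b\<in>S. {y. rat_real.representation B y b \<noteq> 0})" for y
  proof -
    have "card S \<le> card {b. rat_real.representation B y b \<noteq> 0}"
      using that by (intro card_mono rat_real.finite_representation) auto
    then show ?thesis using x by (simp add: S_def)
  qed
  ultimately show "\<exists>T. openin hamel_topology T \<and> x \<in> T \<and>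
      T \<subseteq> {x. n < card {b. rat_real.representation B x b \<noteq> 0}}"
    by (intro exI[of _ "\<Inter>b\<in>S. {y. rat_real.representation B y b \<noteq> 0}"])
      (auto simp: S_def)
qed

text \<open>
  Take for \<open>z\<close> the sum of \<open>n + 1\<close> basis elements outside the support of \<open>x\<close>: nothing can cancel,
  whatever the scaling of \<open>z\<close>.
\<close>

lemma direction_increasing_coordinates:
  assumes B: "hamel_basis B"
  obtains z where
    "\<And>k. n < card {b. rat_real.representation B (x + z / real (Suc k)) b \<noteq> 0}"
proof -
  have ind: "rat_real.independent B" and sp: "\<And>v. v \<in> rat_real.span B"
    using B by (auto simp: hamel_basis_def)
  have "infinite (B - {b. rat_real.representation B x b \<noteq> 0})"
    using hamel_basis_infinite[OF B] by (simp add: rat_real.finite_representation)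
  then obtain S where S: "S \<subseteq> B - {b. rat_real.representation B x b \<noteq> 0}"
      "finite S" "card S = Suc n"
    using infinite_arbitrarily_large by metis
  define z where "z = (\<Sum>c\<in>S. c)"
  have z: "rat_real.representation B z b = 1" if "b \<in> S" for b
  proof -
    have "rat_real.representation B z b = (\<Sum>c\<in>S. rat_real.representation B c b)"
      unfolding z_def using rat_real.representation_sum[OF ind, of S "\<lambda>c. c"] sp by simp
    also have "\<dots> = (\<Sum>c\<in>S. if c = b then 1 else 0)"
      using S by (intro sum.cong refl) (auto simp: rat_real.representation_basis[OF ind])
    also have "\<dots> = 1" using S that by simp
    finally show ?thesis .
  qed
  have "n < card {b. rat_real.representation B (x + z / real (Suc k)) b \<noteq> 0}" for k
  proof -
    have scale: "z / real (Suc k) = of_rat (1 / of_nat (Suc k)) * z"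
      by (simp only: of_rat_divide of_rat_of_nat_eq of_rat_1) simp
    have "rat_real.representation B (x + z / real (Suc k)) b = 1 / of_nat (Suc k)" if "b \<in> S" for b
      unfolding scale rat_real.representation_add[OF ind sp sp]
        rat_real.representation_scale[OF ind sp]
      using S z[OF that] that by auto
    then have "S \<subseteq> {b. rat_real.representation B (x + z / real (Suc k)) b \<noteq> 0}"
      by (auto simp del: of_nat_Suc)
    then show ?thesis
      using card_mono[OF rat_real.finite_representation] S(3) by (metis Suc_le_lessD)
  qed
  then show ?thesis by (rule that)
qed

theorem theorem7p7:
  assumes "\<exists>B. hamel_basis B"
  shows "meager_in hamel_topology (UNIV :: real set)"
proof -
  obtain B where B: "hamel_basis B" using assms by blast
  define L where "L n = {x. card {b. rat_real.representation B x b \<noteq> 0} \<le> n}" for n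
  have "nowhere_dense_in hamel_topology (L n)" for n
  proof -
    have "UNIV - L n = {x. n < card {b. rat_real.representation B x b \<noteq> 0}}"
      by (auto simp: L_def)
    then have "closedin hamel_topology (L n)"
      using openin_hamel_more_than_coordinates[OF B] by (simp add: closedin_def)
    moreover have "x \<notin> hamel_topology interior_of (L n)" for x
    proof
      assume x: "x \<in> hamel_topology interior_of (L n)"
      obtain z where z: "\<And>k. n < card {b. rat_real.representation B (x + z / real (Suc k)) b \<noteq> 0}"
        using direction_increasing_coordinates[OF B] by blast
      obtain k where "x + z / real (Suc k) \<in> hamel_topology interior_of (L n)"
        using eventually_happens'[OF sequentially_bot
            hamel_open_eventually[OF openin_interior_of x]] by blast
      then have "x + z / real (Suc k) \<in> L n"
        by (rule subsetD[OF interior_of_subset])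
      then show False using z[of k] by (simp add: L_def)
    qed
    ultimately show ?thesis
      by (auto simp: nowhere_dense_in_def closure_of_closedin)
  qed
  moreover have "UNIV = \<Union>(range L)"
    by (auto simp: L_def)
  ultimately show ?thesis
    unfolding meager_in_def by (intro exI[of _ "range L"]) auto
qed

end
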